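(* There exist locally checkable problems with the following round complexities in $n$-node graphs in the LOCAL model: (i) $\Theta(\log^\star\log^\star n)$; (ii) $\Theta\big(\log^{\epsilon}(\log^\star n)\big)$, for every real $\epsilon\in(0,1)$; (iii) $\Theta\big(\log^{(k)}(\log^\star n)\big)$, for every integer $k\ge 1$.
   Context: Notation. Logarithms are in base $2$; $\log^{\epsilon}x=(\log x)^{\epsilon}$; $\log^{(k)}$ is the $k$-th iterate of $\log$ ($\log^{(1)}=\log$, $\log^{(k)}=\log\circ\log^{(k-1)}$); $\log^\star n$ is the number of times $\log$ must be applied to $n$ until the result is at most $1$. LOCAL model. The network is a simple connected graph $G=(V,E)$ with $n\ge 1$ nodes. Each node $v$ has an identifier $\mathrm{id}(v)\in[0,N]$, unique in the network, where $N$ is an upper bound on $n$ that is polynomial in $n$; $N$ may be given to the nodes. Initially a node knows only its identifier, its degree and its input label (and $N$), and nothing else about the graph. Computation proceeds in synchronous rounds, all nodes starting at the same round; in each round every node performs arbitrary local computation, sends a message of arbitrary size to each neighbor, and receives its neighbors' messages. Each node eventually outputs a label. The round complexity of a (deterministic) algorithm is the function of $n$ giving the maximum, over all $n$-node graphs (and all identifier and input assignments), of the number of rounds until all nodes have output. Locally checkable problem. A pair $(L,\varphi)$ where $L$ is a finite set of labels and $\varphi$ is a Boolean predicate on $L$-labeled balls of radius $r$ (for some fixed integer $r\ge 0$) in arbitrary graphs (no bound on the degrees); the ball of radius $r$ centered at $v$ is the subgraph induced by the nodes at distance at most $r$ from $v$. Input labels are allowed: $L=L_{in}\times L_{out}$,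 each node $v$ receives an arbitrary $\ell_{in}(v)\in L_{in}$ and must output $\ell_{out}(v)\in L_{out}$. An algorithm solves the problem if for every input graph and every input labeling the produced labeling is such that the labeled ball of radius $r$ around every node satisfies $\varphi$. A problem has round complexity $\Theta(t(n))$ if some algorithm solves it in $O(t(n))$ rounds and every algorithm solving it has round complexity $\Omega(t(n))$. *)

theory Defs
  imports Complex_Main "HOL-Library.Extended_Real" "HOL-Library.Landau_Symbols"
begin

section \<open>Iterated logarithms\<close>

text \<open>All iterates before the last one exceed 1, so \<^term>\<open>log 2\<close> is only ever applied to
  positive reals here.\<close>

definition log_star :: "real \<Rightarrow> nat" where
  "log_star x = (LEAST i. (log 2 ^^ i) x \<le> 1)"

section \<open>Networks\<close>

text \<open>Nodes are named by natural numbers, which covers every finite graph up to isomorphism.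
  The names are visible neither to the algorithms nor to the predicates defining problems.
  The map \<open>port G v\<close> enumerates the neighbors of \<open>v\<close>, so that \<open>v\<close> can address each of them
  separately; it is chosen adversarially.\<close>

type_synonym node = nat

record network =
  verts :: "node set"
  edges :: "node rel"
  ident :: "node \<Rightarrow> nat"
  inp :: "node \<Rightarrow> nat"
  port :: "node \<Rightarrow> nat \<Rightarrow> node"

definition nbrs :: "network \<Rightarrow> node \<Rightarrow> node set" where
  "nbrs G v = edges G `` {v}"

definition deg :: "network \<Rightarrow> node \<Rightarrow> nat" where
  "deg G v = card (nbrs G v)"

definition port_to :: "network \<Rightarrow> node \<Rightarrow> node \<Rightarrow> nat" where
  "port_to G u v = (THE j. j < deg G u \<and> port G u j = v)"

definition simple_connected_graph :: "node set \<Rightarrow> node rel \<Rightarrow> bool" where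
  "simple_connected_graph V E \<longleftrightarrow>
     finite V \<and> V \<noteq> {} \<and> E \<subseteq> V \<times> V \<and> sym E \<and> irrefl E \<and> V \<times> V \<subseteq> E\<^sup>*"

text \<open>\<open>N\<close> bounds the identifiers, and \<open>Lin\<close> is the set of input labels.\<close>

definition is_network :: "nat \<Rightarrow> nat set \<Rightarrow> network \<Rightarrow> bool" where
  "is_network N Lin G \<longleftrightarrow>
     simple_connected_graph (verts G) (edges G) \<and>
     inj_on (ident G) (verts G) \<and> ident G ` verts G \<subseteq> {0..N} \<and>
     inp G ` verts G \<subseteq> Lin \<and>
     (\<forall>v\<in>verts G. bij_betw (port G v) {..<deg G v} (nbrs G v))"

section \<open>Deterministic algorithms in the LOCAL model\<close>

text \<open>The functions are arbitrary (not necessarily computable) and states and messages are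
  unbounded. Encoding them as natural numbers loses no generality: there are only countably many
  possible initial data, hence only countably many reachable states and messages.

  \<open>init N i d l\<close> is the initial state of a node of identifier \<open>i\<close>, degree \<open>d\<close> and input label
  \<open>l\<close>; \<open>send s j\<close> is the message sent through port \<open>j\<close>; \<open>receive s ms\<close> is the state after
  receiving the messages \<open>ms\<close>, listed by port.\<close>

record algorithm =
  init :: "nat \<Rightarrow> nat \<Rightarrow> nat \<Rightarrow> nat \<Rightarrow> nat"
  send :: "nat \<Rightarrow> nat \<Rightarrow> nat"
  receive :: "nat \<Rightarrow> nat list \<Rightarrow> nat"
  result :: "nat \<Rightarrow> nat option"

primrec state :: "algorithm \<Rightarrow> nat \<Rightarrow> network \<Rightarrow> nat \<Rightarrow> node \<Rightarrow> nat" where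
  "state A N G 0 v = init A N (ident G v) (deg G v) (inp G v)"
| "state A N G (Suc t) v =
     receive A (state A N G t v)
       (map (\<lambda>i. send A (state A N G t (port G v i)) (port_to G (port G v i) v)) [0..<deg G v])"

definition has_output :: "algorithm \<Rightarrow> nat \<Rightarrow> network \<Rightarrow> node \<Rightarrow> nat \<Rightarrow> bool" where
  "has_output A N G v t \<longleftrightarrow> result A (state A N G t v) \<noteq> None"

text \<open>Outputs are irrevocable: the first one counts. A node may keep communicating afterwards.\<close>

definition out_label :: "algorithm \<Rightarrow> nat \<Rightarrow> network \<Rightarrow> node \<Rightarrow> nat" where
  "out_label A N G v = the (result A (state A N G (LEAST t. has_output A N G v t) v))"

text \<open>This is \<^term>\<open>\<infinity>\<close> if some node never outputs.\<close>

definition rounds :: "algorithm \<Rightarrow> nat \<Rightarrow> network \<Rightarrow> enat" where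
  "rounds A N G = (SUP v\<in>verts G. INF t\<in>{t. has_output A N G v t}. enat t)"

section \<open>Locally checkable problems\<close>

record ball =
  bverts :: "node set"
  bedges :: "node rel"
  bcenter :: node
  blabel :: "node \<Rightarrow> nat \<times> nat"

definition ball_around :: "network \<Rightarrow> (node \<Rightarrow> nat) \<Rightarrow> nat \<Rightarrow> node \<Rightarrow> ball" where
  "ball_around G out r v =
     (let B = {w. \<exists>k\<le>r. (v, w) \<in> edges G ^^ k} in
      \<lparr>bverts = B, bedges = edges G \<inter> B \<times> B, bcenter = v, blabel = (\<lambda>w. (inp G w, out w))\<rparr>)"

definition ball_iso :: "ball \<Rightarrow> ball \<Rightarrow> bool" where
  "ball_iso B B' \<longleftrightarrow> (\<exists>f. bij_betw f (bverts B) (bverts B') \<and> f (bcenter B) = bcenter B' \<and>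
     (\<forall>u\<in>bverts B. \<forall>w\<in>bverts B. (u, w) \<in> bedges B \<longleftrightarrow> (f u, f w) \<in> bedges B') \<and>
     (\<forall>u\<in>bverts B. blabel B' (f u) = blabel B u))"

record problem =
  in_labels :: "nat set"
  out_labels :: "nat set"
  radius :: nat
  accepts :: "ball \<Rightarrow> bool"

text \<open>Isomorphism invariance makes the predicate depend only on the labeled centered ball, and
  not on node names (nor on label values outside of the ball).\<close>

definition locally_checkable :: "problem \<Rightarrow> bool" where
  "locally_checkable P \<longleftrightarrow>
     finite (in_labels P) \<and> finite (out_labels P) \<and>
     (\<forall>B B'. ball_iso B B' \<longrightarrow> accepts P B = accepts P B')"

section \<open>Round complexity\<close>

text \<open>The upper bound \<open>N\<close> on the number of nodes, as a function of that number.\<close>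

definition poly_upper_bound :: "(nat \<Rightarrow> nat) \<Rightarrow> bool" where
  "poly_upper_bound N \<longleftrightarrow>
     (\<forall>n. n \<le> N n) \<and> (\<exists>c. (\<lambda>n. real (N n)) \<in> O(\<lambda>n. real n ^ c))"

definition instances :: "problem \<Rightarrow> (nat \<Rightarrow> nat) \<Rightarrow> nat \<Rightarrow> network set" where
  "instances P N n = {G. is_network (N n) (in_labels P) G \<and> card (verts G) = n}"

definition solves :: "algorithm \<Rightarrow> (nat \<Rightarrow> nat) \<Rightarrow> problem \<Rightarrow> bool" where
  "solves A N P \<longleftrightarrow> (\<forall>n. \<forall>G\<in>instances P N n. \<forall>v\<in>verts G.
     (\<exists>t. has_output A (N n) G v t) \<and>
     out_label A (N n) G v \<in> out_labels P \<and>
     accepts P (ball_around G (out_label A (N n) G) (radius P) v))"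

definition round_complexity :: "algorithm \<Rightarrow> (nat \<Rightarrow> nat) \<Rightarrow> problem \<Rightarrow> nat \<Rightarrow> enat" where
  "round_complexity A N P n = (SUP G\<in>instances P N n. rounds A (N n) G)"

text \<open>The usual big-O and big-Omega, for functions that may a priori take the value \<^term>\<open>\<infinity>\<close>.\<close>

definition in_bigo :: "(nat \<Rightarrow> enat) \<Rightarrow> (nat \<Rightarrow> real) \<Rightarrow> bool" where
  "in_bigo T t \<longleftrightarrow>
     (\<exists>C>0. \<forall>\<^sub>F n in sequentially. ereal_of_enat (T n) \<le> ereal (C * t n))"

definition in_bigomega :: "(nat \<Rightarrow> enat) \<Rightarrow> (nat \<Rightarrow> real) \<Rightarrow> bool" where
  "in_bigomega T t \<longleftrightarrow>
     (\<exists>c>0. \<forall>\<^sub>F n in sequentially. ereal (c * t n) \<le> ereal_of_enat (T n))"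

text \<open>The bound must hold whatever the polynomially bounded \<open>N\<close> of the model is.\<close>

definition has_complexity_Theta :: "problem \<Rightarrow> (nat \<Rightarrow> real) \<Rightarrow> bool" where
  "has_complexity_Theta P t \<longleftrightarrow> (\<forall>N. poly_upper_bound N \<longrightarrow>
     (\<exists>A. solves A N P \<and> in_bigo (round_complexity A N P) t) \<and>
     (\<forall>A. solves A N P \<longrightarrow> in_bigomega (round_complexity A N P) t))"

end

theory Submission
  imports Defs "HOL-Library.Countable"
begin

text \<open>Since degrees are unbounded, a node of degree \<open>d\<close> certifies that the network has more than \<open>d\<close>
  nodes. Let \<open>lev\<close> be a monotone function growing like the target complexity. A node having a
  non-leaf neighbor of smaller level, where the level of a node is \<open>lev\<close> of its degree, must copy
  the output of such a neighbor; every other node outputs its own input. Levels decrease along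
  chains of copies, so these have length at most \<open>lev n\<close> and waiting for the neighbor to answer solves
  the problem in \<open>lev n + 1\<close> rounds. Conversely, in a caterpillar whose spine nodes have just enough
  legs to be of levels \<open>1, 2, 3, \<dots>\<close>, a bit has to travel along the whole spine. Because
  \<open>lev (2 d + 1) \<le> lev d + 1\<close>, the degrees along the spine at least double, so that a spine with
  \<open>lev n - 2\<close> levels fits into \<open>n\<close> nodes.\<close>

section \<open>Slowly growing functions of the iterated logarithm\<close>

text \<open>The tangent bound for \<open>ln\<close> at 1, applied to \<open>x / 2\<close>, gives
  slope 1/2, and \<open>ln 2 \<ge> 1/2\<close>. Hence every logarithm subtracts at least 1 from an
  argument above 2.\<close>

lemma log2_le_minus_1:
  fixes x :: real
  assumes "2 \<le> x"
  shows "log 2 x \<le> x - 1"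
proof -
  have l: "1 / 2 \<le> ln (2::real)"
  proof -
    have "ln (1 / 2 :: real) \<le> 1 / 2 - 1" by (rule ln_le_minus_one) simp
    then show ?thesis by (simp add: ln_div)
  qed
  have "ln (x / 2) \<le> x / 2 - 1" using assms by (intro ln_le_minus_one) simp
  then have "ln x - ln 2 \<le> x / 2 - 1" using assms by (simp add: ln_div)
  also have "\<dots> \<le> (x - 2) * ln 2" using mult_left_mono[OF l, of "x - 2"] assms by simp
  finally have "ln x \<le> (x - 1) * ln 2" by (simp add: algebra_simps)
  then show ?thesis by (simp add: log_def field_simps)
qed

text \<open>Makes the \<open>LEAST\<close> in \<open>log_star\<close> meaningful. The induction is
  on an integer above \<open>x\<close>, which drops by one with each logarithm.\<close>

lemma log_iter_le_1: "\<exists>i. (log 2 ^^ i) x \<le> 1"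
proof -
  have "\<exists>i. (log 2 ^^ i) x \<le> 1" if "x \<le> real n" for n x
    using that
  proof (induction n arbitrary: x)
    case 0
    then show ?case by (intro exI[of _ 0]) simp
  next
    case (Suc n)
    consider "x \<le> 1" | "1 < x" "x \<le> 2" | "2 < x" by linarith
    then show ?case
    proof cases
      case 1
      then show ?thesis by (intro exI[of _ 0]) simp
    next
      case 2
      then show ?thesis by (intro exI[of _ 1]) simp
    next
      case 3
      then have "log 2 x \<le> real n" using log2_le_minus_1[of x] Suc.prems by simp
      then obtain i where "(log 2 ^^ i) (log 2 x) \<le> 1" using Suc.IH by blast
      then show ?thesis by (intro exI[of _ "Suc i"]) (simp add: funpow_Suc_right del: funpow.simps)
    qed
  qed
  then show ?thesis using real_arch_simple by blast
qed

lemma log_star_eq_0: "x \<le> 1 \<Longrightarrow> log_star x = 0"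
  unfolding log_star_def by (rule Least_eq_0) simp

lemma log_star_Suc:
  assumes "1 < x"
  shows "log_star x = Suc (log_star (log 2 x))"
proof -
  obtain i where i: "(log 2 ^^ i) x \<le> 1" using log_iter_le_1 by blast
  have "log_star x = Suc (LEAST m. (log 2 ^^ Suc m) x \<le> 1)"
    unfolding log_star_def using i by (rule Least_Suc) (use assms in simp)
  then show ?thesis by (simp add: log_star_def funpow_Suc_right del: funpow.simps)
qed

lemma log_star_mono: "x \<le> y \<Longrightarrow> log_star x \<le> log_star y"
proof (induction "log_star y" arbitrary: x y)
  case 0
  then have "y \<le> 1" using log_star_Suc by (metis Zero_not_Suc not_less)
  then show ?case using 0 by (simp add: log_star_eq_0)
next
  case (Suc n)
  show ?case
  proof (cases "1 < x")
    case True
    then have "log_star (log 2 x) \<le> log_star (log 2 y)"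
      using Suc.prems Suc.hyps(2) log_star_Suc[of y] by (intro Suc.hyps(1)) auto
    then show ?thesis using True Suc.prems by (simp add: log_star_Suc)
  qed (simp add: log_star_eq_0)
qed

text \<open>From \<open>d = 3\<close> on, \<open>2 * d + 1 \<le> 2 ^ d\<close>, and one logarithm
  undoes the exponential. This keeps levels from jumping when a degree doubles.\<close>

lemma log_star_double:
  assumes "3 \<le> d"
  shows "log_star (real (2 * d + 1)) \<le> Suc (log_star (real d))"
proof -
  have "2 * d + 1 \<le> 2 ^ d" using assms by (induction rule: dec_induct) auto
  then have "real (2 * d + 1) \<le> 2 powr real d"
    by (metis of_nat_le_iff of_nat_numeral of_nat_power powr_realpow zero_less_numeral)
  then have "log 2 (real (2 * d + 1)) \<le> real d" by (simp add: log_le_iff)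
  then show ?thesis using assms log_star_Suc[of "real (2 * d + 1)"] log_star_mono by auto
qed

lemma filterlim_log_star: "filterlim (\<lambda>n. log_star (real n)) at_top sequentially"
proof -
  have "\<exists>n. k \<le> log_star (real n)" for k
  proof (induction k)
    case (Suc k)
    then obtain n where n: "k \<le> log_star (real n)" by blast
    \<comment> \<open>The exponent \<open>Suc n\<close> keeps the argument above 1 even for
      \<open>n = 0\<close>.\<close>
    have "log_star (real (2 ^ Suc n)) = Suc (log_star (real (Suc n)))"
      by (subst log_star_Suc) (simp_all add: log_nat_power one_less_power del: power_Suc)
    also have "\<dots> \<ge> Suc k" using n log_star_mono[of n "Suc n"] by simp
    finally show ?case by blast
  qed simp
  then show ?thesis
    unfolding filterlim_at_top eventually_sequentially
    by (meson log_star_mono of_nat_le_iff order_trans)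
qed

section \<open>Functions whose increments are at most 1\<close>

lemma log_step:
  assumes "1 \<le> x" "y \<le> x + 1" "x \<le> y"
  shows "log 2 x \<le> log 2 y" "log 2 y \<le> log 2 x + 1"
proof -
  show "log 2 x \<le> log 2 y" using assms by simp
  have "log 2 y \<le> log 2 (2 * x)" using assms by simp
  then show "log 2 y \<le> log 2 x + 1" using assms by (simp add: log_mult)
qed

text \<open>Since \<open>y \<le> x * (1 + 1 / x)\<close> and
  \<open>(1 + 1 / x) powr e \<le> 1 + 1 / x\<close>, the increment is at most
  \<open>x powr (e - 1) \<le> 1\<close>.\<close>

lemma powr_step:
  assumes "1 \<le> x" "y \<le> x + 1" "x \<le> y" "0 < e" "e < (1::real)"
  shows "x powr e \<le> y powr e" "y powr e \<le> x powr e + 1"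
proof -
  show "x powr e \<le> y powr e" using assms by (intro powr_mono2) auto
  have "y powr e \<le> (x * (1 + 1 / x)) powr e"
    using assms by (intro powr_mono2) (auto simp: distrib_left)
  also have "\<dots> = x powr e * (1 + 1 / x) powr e" using assms by (simp add: powr_mult)
  also have "\<dots> \<le> x powr e * (1 + 1 / x) powr 1"
    using assms by (intro mult_left_mono powr_mono) auto
  also have "\<dots> = x powr e + x powr (e - 1)" using assms by (simp add: powr_diff field_simps)
  also have "x powr (e - 1) \<le> x powr 0" using assms by (intro powr_mono) auto
  finally show "y powr e \<le> x powr e + 1" using assms by simp
qed

text \<open>Increments between 0 and 1 are what allows rounding to integer levels that rise one at a
  time. They are asked for only eventually, because iterated logarithms misbehave at small
  arguments.\<close>

definition slow :: "(nat \<Rightarrow> real) \<Rightarrow> bool" where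
  "slow g \<longleftrightarrow> filterlim g at_top sequentially \<and>
     (\<forall>\<^sub>F p in sequentially. g p \<le> g (Suc p) \<and> g (Suc p) \<le> g p + 1)"

lemma slow_of_nat: "slow real"
  by (simp add: slow_def filterlim_real_sequentially)

lemma slow_log_star: "slow (\<lambda>p. real (log_star (real p)))"
  unfolding slow_def
proof
  show "filterlim (\<lambda>p. real (log_star (real p))) at_top sequentially"
    using filterlim_compose[OF filterlim_real_sequentially filterlim_log_star] .
  show "\<forall>\<^sub>F p in sequentially. real (log_star (real p)) \<le> real (log_star (real (Suc p))) \<and>
      real (log_star (real (Suc p))) \<le> real (log_star (real p)) + 1"
    using eventually_ge_at_top[of 3]
  proof eventually_elim
    case (elim p)
    have "log_star (real (Suc p)) \<le> log_star (real (2 * p + 1))" by (rule log_star_mono) simp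
    then show ?case using log_star_double[OF elim] log_star_mono[of p "Suc p"] by simp
  qed
qed

lemma slow_compose:
  assumes "slow g" "filterlim h at_top at_top"
    and step: "\<And>x y. 1 \<le> x \<Longrightarrow> y \<le> x + 1 \<Longrightarrow> x \<le> y \<Longrightarrow> h x \<le> h y \<and> h y \<le> h x + (1::real)"
  shows "slow (\<lambda>p. h (g p))"
  unfolding slow_def
proof
  have g: "filterlim g at_top sequentially" using assms(1) by (simp add: slow_def)
  show "filterlim (\<lambda>p. h (g p)) at_top sequentially" using filterlim_compose[OF assms(2) g] .
  have "\<forall>\<^sub>F p in sequentially. 1 \<le> g p" using g by (simp add: filterlim_at_top)
  moreover have "\<forall>\<^sub>F p in sequentially. g p \<le> g (Suc p) \<and> g (Suc p) \<le> g p + 1"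
    using assms(1) by (simp add: slow_def)
  ultimately show "\<forall>\<^sub>F p in sequentially. h (g p) \<le> h (g (Suc p)) \<and> h (g (Suc p)) \<le> h (g p) + 1"
    by eventually_elim (use step in auto)
qed

lemma slow_log: "slow g \<Longrightarrow> slow (\<lambda>p. log 2 (g p))"
proof (erule slow_compose)
  have "filterlim (\<lambda>x::real. 1 / ln 2 * ln x) at_top at_top"
    by (rule filterlim_tendsto_pos_mult_at_top[OF tendsto_const _ ln_at_top]) simp
  then show "filterlim (\<lambda>x::real. log 2 x) at_top at_top" by (simp add: log_def)
qed (use log_step in auto)

lemma slow_powr:
  assumes "slow g" "0 < e" "e < 1"
  shows "slow (\<lambda>p. g p powr e)"
  using assms(1)
proof (rule slow_compose)
  show "filterlim (\<lambda>x::real. x powr e) at_top at_top"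
  proof (rule filterlim_cong[OF refl refl, THEN iffD1])
    show "\<forall>\<^sub>F x in at_top. exp (e * ln x) = x powr e"
      using eventually_gt_at_top[of "0::real"] by eventually_elim (simp add: powr_def)
    show "filterlim (\<lambda>x::real. exp (e * ln x)) at_top at_top"
      by (intro filterlim_compose[OF exp_at_top]
          filterlim_tendsto_pos_mult_at_top[OF tendsto_const assms(2) ln_at_top])
  qed
qed (use powr_step assms in auto)

lemma slow_log_iter: "slow (\<lambda>p. (log 2 ^^ k) (real p))"
  by (induction k) (auto simp: slow_of_nat intro: slow_log)

text \<open>The level of a degree is \<open>g\<close> of its \<open>log_star\<close>, rounded down,
  frozen below a threshold and shifted to start at 0. Rounding and shift cost a constant, which the
  factor 2 absorbs because \<open>g\<close> is unbounded.\<close>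

lemma slow_levels:
  assumes "slow g"
  obtains lev :: "nat \<Rightarrow> nat"
  where "mono lev" "\<And>d. lev (2 * d + 1) \<le> Suc (lev d)" "lev 2 = 0"
    "filterlim lev at_top sequentially"
    "\<forall>\<^sub>F n in sequentially. real (lev n) \<le> g (log_star (real n))"
    "\<forall>\<^sub>F n in sequentially. g (log_star (real n)) \<le> 2 * real (lev n)"
proof -
  have lim: "filterlim g at_top sequentially" using assms by (simp add: slow_def)
  \<comment> \<open>The condition \<open>3 \<le> p\<close> makes level 0 extend at least up to
    \<open>log_star\<close> equal to 3.\<close>
  have "\<forall>\<^sub>F p in sequentially. 0 \<le> g p \<and> 3 \<le> p \<and> g p \<le> g (Suc p) \<and> g (Suc p) \<le> g p + 1"
    using assms lim eventually_ge_at_top[of 3]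
    by (auto simp: slow_def filterlim_at_top intro!: eventually_conj)
  then obtain p0 where p0: "0 \<le> g p" "3 \<le> p" "g p \<le> g (Suc p)" "g (Suc p) \<le> g p + 1" if "p \<ge> p0" for p
    by (auto simp: eventually_sequentially)
  define f where "f p = nat \<lfloor>g (max p0 p)\<rfloor> - nat \<lfloor>g p0\<rfloor>" for p
  define lev where "lev d = f (log_star (real d))" for d
  have "f p \<le> f (Suc p)" for p
    using p0(3)[of "max p0 p"] p0(1)[of p0]
    by (cases "p0 \<le> p") (auto simp: f_def max_def intro!: diff_le_mono nat_mono floor_mono not_less_eq_eq)
  then have f_mono: "p \<le> q \<Longrightarrow> f p \<le> f q" for p q by (rule lift_Suc_mono_le)
  have f_step: "f (Suc p) \<le> Suc (f p)" for p
  proof (cases "p0 \<le> p")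
    case True
    then have "\<lfloor>g (Suc p)\<rfloor> \<le> \<lfloor>g p\<rfloor> + 1" "0 \<le> \<lfloor>g p\<rfloor>"
      using p0(4)[of p] p0(1)[of p] by linarith+
    then show ?thesis using True by (simp add: f_def max_def)
  qed (auto simp: f_def max_def not_le le_Suc_eq)
  have f0: "f p = 0" if "p \<le> 3" for p
    using that p0(2)[of p0] by (simp add: f_def max_absorb1)
  have lev_mono: "lev d \<le> lev d'" if "d \<le> d'" for d d'
    unfolding lev_def using that by (intro f_mono log_star_mono) simp
  \<comment> \<open>The doubling estimate for \<open>log_star\<close> starts at
    \<open>d = 3\<close>. For smaller \<open>d\<close>, \<open>2 * d + 1 \<le> 5\<close>, so level 0
    must reach up to degree 5.\<close>
  have five: "log_star 5 \<le> 3"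
  proof -
    have a: "log 2 (5::real) \<le> 4" by (simp add: log_le_iff)
    have b: "log_star 4 = Suc (log_star (2::real))"
    proof -
      have "log 2 (4::real) = 2" using log_pow_cancel[of "2::real" 2] by simp
      then show ?thesis by (subst log_star_Suc) auto
    qed
    have "log_star 2 = Suc 0" by (simp add: log_star_Suc log_star_eq_0)
    then show ?thesis using log_star_mono[OF a] b by (simp add: log_star_Suc)
  qed
  have lev5: "lev 5 = 0" using f0 five by (simp add: lev_def)
  have ls: "\<forall>\<^sub>F n in sequentially. p0 \<le> log_star (real n)"
    using filterlim_log_star by (simp add: filterlim_at_top)
  have comp: "filterlim (\<lambda>n. g (log_star (real n))) at_top sequentially"
    using filterlim_compose[OF lim filterlim_log_star] .
  \<comment> \<open>Rounding loses at most 1 and the shift at most \<open>g p0\<close>; together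
    this is at most half of such a value of \<open>g\<close>.\<close>
  have "\<forall>\<^sub>F n in sequentially. 2 + 2 * g p0 \<le> g (log_star (real n))"
    using comp by (simp add: filterlim_at_top)
  with ls have up: "\<forall>\<^sub>F n in sequentially. g (log_star (real n)) \<le> 2 * real (lev n)"
  proof eventually_elim
    case (elim n)
    have "0 \<le> g p0" using p0(1) by blast
    then have "real (lev n) \<ge> g (log_star (real n)) - 1 - g p0"
      using elim by (simp add: lev_def f_def max_def) linarith
    then show ?case using elim by linarith
  qed
  have "lev (2 * d + 1) \<le> Suc (lev d)" for d
  proof (cases "3 \<le> d")
    case True
    then show ?thesis
      unfolding lev_def using f_mono[OF log_star_double[OF True]] f_step order_trans by blast
  next
    case False
    then show ?thesis using lev5 lev_mono[of "2 * d + 1" 5] by simp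
  qed
  moreover have "lev 2 = 0" using lev5 lev_mono[of 2 5] by simp
  moreover have "mono lev" using lev_mono by (rule monoI)
  moreover have "\<forall>\<^sub>F n in sequentially. real (lev n) \<le> g (log_star (real n))"
    using ls
  proof eventually_elim
    case (elim n)
    have "real (lev n) \<le> real (nat \<lfloor>g (log_star (real n))\<rfloor>)"
      using elim by (simp add: lev_def f_def max_def)
    also have "\<dots> \<le> g (log_star (real n))" using p0(1)[OF elim] by (rule of_nat_floor)
    finally show ?case .
  qed
  moreover have "filterlim lev at_top sequentially"
    unfolding filterlim_at_top
  proof
    fix k
    have "\<forall>\<^sub>F n in sequentially. 2 * real k \<le> g (log_star (real n))"
      using comp by (simp add: filterlim_at_top)
    with up show "\<forall>\<^sub>F n in sequentially. k \<le> lev n" by eventually_elim linarith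
  qed
  ultimately show ?thesis using that up by blast
qed

section \<open>The relay problem and its upper bound\<close>

text \<open>Leaves are excluded because a spine node of a caterpillar could otherwise copy one of
  its own legs. The argument is an edge relation so that it can be that of a graph or of a
  ball.\<close>

definition lower_nbr :: "(nat \<Rightarrow> nat) \<Rightarrow> node rel \<Rightarrow> node \<Rightarrow> node \<Rightarrow> bool" where
  "lower_nbr lev E v w \<longleftrightarrow>
     (v, w) \<in> E \<and> 1 < card (E `` {w}) \<and> lev (card (E `` {w})) < lev (card (E `` {v}))"

definition relay_ok :: "(nat \<Rightarrow> nat) \<Rightarrow> node rel \<Rightarrow> (node \<Rightarrow> nat \<times> nat) \<Rightarrow> node \<Rightarrow> bool" where
  "relay_ok lev E lab v \<longleftrightarrow>
     (if \<exists>w. lower_nbr lev E v w then \<exists>w. lower_nbr lev E v w \<and> snd (lab w) = snd (lab v)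
      else snd (lab v) = fst (lab v))"

text \<open>An isomorphism of balls may send a center outside of its ball anywhere, so isomorphism
  invariance forces a predicate to ignore the center. The accepting condition therefore only asks
  for some vertex at distance at most 2 from the whole ball.\<close>

definition central :: "node set \<Rightarrow> node rel \<Rightarrow> node \<Rightarrow> bool" where
  "central V R c \<longleftrightarrow> c \<in> V \<and> (\<forall>u\<in>V. u = c \<or> (c, u) \<in> R \<or> (c, u) \<in> R O R)"

text \<open>The edges are cut down to \<open>bverts B\<close> because \<open>ball_iso\<close> does
  not constrain edges leaving that set.\<close>

definition relay_accepts :: "(nat \<Rightarrow> nat) \<Rightarrow> ball \<Rightarrow> bool" where
  "relay_accepts lev B \<longleftrightarrow>
     (let R = bedges B \<inter> bverts B \<times> bverts B
      in \<exists>c. central (bverts B) R c \<and> relay_ok lev R (blabel B) c)"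

text \<open>With radius 2, the degrees of the neighbors of the center can be read off the
  ball.\<close>

definition relay_problem :: "(nat \<Rightarrow> nat) \<Rightarrow> problem" where
  "relay_problem lev =
     \<lparr>in_labels = {0, 1}, out_labels = {0, 1}, radius = 2, accepts = relay_accepts lev\<rparr>"

text \<open>The predicate is built from the restricted relation, cardinalities of its images, and
  labels. All of these transfer along \<open>f\<close>, and witnesses on the other side are images
  under \<open>f\<close>, as the restricted relation stays inside the ball.\<close>

lemma relay_accepts_iso:
  assumes "ball_iso B B'"
  shows "relay_accepts lev B = relay_accepts lev B'"
proof -
  obtain f where f: "bij_betw f (bverts B) (bverts B')"
    and e: "\<And>u w. u \<in> bverts B \<Longrightarrow> w \<in> bverts B \<Longrightarrow>
      (u, w) \<in> bedges B \<longleftrightarrow> (f u, f w) \<in> bedges B'"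
    and l: "\<And>u. u \<in> bverts B \<Longrightarrow> blabel B' (f u) = blabel B u"
    using assms unfolding ball_iso_def by blast
  define V V' where "V = bverts B" and "V' = bverts B'"
  define R R' where "R = bedges B \<inter> V \<times> V" and "R' = bedges B' \<inter> V' \<times> V'"
  have V': "V' = f ` V" and inj: "inj_on f V"
    using f by (auto simp: bij_betw_def V_def V'_def)
  have RV: "u \<in> V" "w \<in> V" if "(u, w) \<in> R" for u w
    using that by (auto simp: R_def)
  have RR: "(f u, f w) \<in> R' \<longleftrightarrow> (u, w) \<in> R" if "u \<in> V" "w \<in> V" for u w
    using that e[of u w] by (auto simp: R_def R'_def V' V_def)
  have img: "R' `` {f v} = f ` (R `` {v})" if "v \<in> V" for v
  proof (intro equalityI subsetI)
    fix y assume y: "y \<in> R' `` {f v}"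
    then obtain w where "w \<in> V" "y = f w" by (auto simp: R'_def V')
    with y that show "y \<in> f ` (R `` {v})" using RR by auto
  qed (use that RR RV in auto)
  have crd: "card (R' `` {f v}) = card (R `` {v})" if "v \<in> V" for v
    unfolding img[OF that] by (intro card_image inj_on_subset[OF inj]) (use RV in auto)
  have low: "lower_nbr lev R' (f v) (f w) \<longleftrightarrow> lower_nbr lev R v w" if "v \<in> V" "w \<in> V" for v w
    using that by (simp add: lower_nbr_def crd RR)
  have lowV: "w \<in> V" if "lower_nbr lev R v w" for v w
    using that RV by (auto simp: lower_nbr_def)
  have lowV': "\<exists>w'\<in>V. w = f w'" if "lower_nbr lev R' v w" for v w
    using that by (auto simp: lower_nbr_def R'_def V')
  have ok: "relay_ok lev R' (blabel B') (f v) \<longleftrightarrow> relay_ok lev R (blabel B) v" if v: "v \<in> V" for v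
  proof -
    have "(\<exists>w. lower_nbr lev R' (f v) w) \<longleftrightarrow> (\<exists>w. lower_nbr lev R v w)"
      using low[OF v] lowV lowV' by blast
    moreover have "(\<exists>w. lower_nbr lev R' (f v) w \<and> snd (blabel B' w) = snd (blabel B' (f v))) \<longleftrightarrow>
        (\<exists>w. lower_nbr lev R v w \<and> snd (blabel B w) = snd (blabel B v))"
      using low[OF v] lowV lowV' l v unfolding V_def by metis
    ultimately show ?thesis using v l by (simp add: relay_ok_def V_def)
  qed
  have OO: "(f u, f w) \<in> R' O R' \<longleftrightarrow> (u, w) \<in> R O R" if uw: "u \<in> V" "w \<in> V" for u w
  proof
    assume "(f u, f w) \<in> R' O R'"
    then obtain y where y: "(f u, y) \<in> R'" "(y, f w) \<in> R'" by blast
    then obtain x where "x \<in> V" "y = f x" by (auto simp: R'_def V')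
    with y uw RR show "(u, w) \<in> R O R" by blast
  next
    assume "(u, w) \<in> R O R"
    then obtain x where "(u, x) \<in> R" "(x, w) \<in> R" by blast
    then show "(f u, f w) \<in> R' O R'" using RR RV by blast
  qed
  have cen: "central V' R' (f c) \<longleftrightarrow> central V R c" if c: "c \<in> V" for c
    unfolding central_def V' using c RR OO inj by (auto simp: inj_on_eq_iff)
  have "(\<exists>c. central V' R' c \<and> relay_ok lev R' (blabel B') c) \<longleftrightarrow>
      (\<exists>c. central V R c \<and> relay_ok lev R (blabel B) c)"
  proof
    assume "\<exists>c. central V' R' c \<and> relay_ok lev R' (blabel B') c"
    then obtain c where c: "central V' R' c" "relay_ok lev R' (blabel B') c" by blast
    then obtain c0 where "c0 \<in> V" "c = f c0" by (auto simp: central_def V')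
    with c cen ok show "\<exists>c. central V R c \<and> relay_ok lev R (blabel B) c" by blast
  next
    assume "\<exists>c. central V R c \<and> relay_ok lev R (blabel B) c"
    then obtain c where c: "central V R c" "relay_ok lev R (blabel B) c" by blast
    then have "c \<in> V" by (simp add: central_def)
    with c cen ok show "\<exists>c. central V' R' c \<and> relay_ok lev R' (blabel B') c" by blast
  qed
  then show ?thesis
    by (simp add: relay_accepts_def Let_def R_def R'_def V_def V'_def)
qed

lemma locally_checkable_relay_problem: "locally_checkable (relay_problem lev)"
  unfolding locally_checkable_def relay_problem_def using relay_accepts_iso by simp

section \<open>The predicate on balls of radius 2 in a network\<close>

lemma ball_around_simps:
  "bverts (ball_around G out r v) = {w. \<exists>k\<le>r. (v, w) \<in> edges G ^^ k}"
  "bedges (ball_around G out r v) = edges G \<inter> bverts (ball_around G out r v) \<times> bverts (ball_around G out r v)"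
  "blabel (ball_around G out r v) = (\<lambda>w. (inp G w, out w))"
  by (simp_all add: ball_around_def Let_def)

lemma ball2_verts:
  "bverts (ball_around G out 2 v) = {w. w = v \<or> (v, w) \<in> edges G \<or> (v, w) \<in> edges G O edges G}"
proof -
  have "(\<exists>k\<le>2. (v, w) \<in> edges G ^^ k) \<longleftrightarrow> w = v \<or> (v, w) \<in> edges G \<or> (v, w) \<in> edges G O edges G" for w
  proof -
    have "(\<exists>k\<le>2. P k) \<longleftrightarrow> P 0 \<or> P 1 \<or> P 2" for P :: "nat \<Rightarrow> bool"
      by (auto simp: le_Suc_eq numeral_2_eq_2)
    then show ?thesis by (auto simp: numeral_2_eq_2)
  qed
  then show ?thesis by (simp add: ball_around_simps)
qed

text \<open>The neighborhoods of \<open>v\<close> and of its neighbors lie entirely inside the ball,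
  so degrees agree there.\<close>

lemma relay_ok_ball:
  fixes G :: network and out :: "node \<Rightarrow> nat" and v :: node
  defines "B \<equiv> ball_around G out 2 v"
  shows "relay_ok lev (bedges B) (blabel B) v \<longleftrightarrow>
    relay_ok lev (edges G) (\<lambda>w. (inp G w, out w)) v"
proof -
  have img: "bedges B `` {w} = edges G `` {w}" if "w = v \<or> (v, w) \<in> edges G" for w
    unfolding B_def ball_around_simps(2) ball2_verts using that by auto
  have "lower_nbr lev (bedges B) v w \<longleftrightarrow> lower_nbr lev (edges G) v w" for w
  proof -
    have "(v, w) \<in> bedges B \<longleftrightarrow> (v, w) \<in> edges G" using img[of v] by auto
    then show ?thesis using img[of v] img[of w] by (auto simp: lower_nbr_def)
  qed
  then show ?thesis by (simp add: relay_ok_def B_def ball_around_simps)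
qed

lemma central_ball:
  fixes G :: network and out :: "node \<Rightarrow> nat" and v :: node
  defines "B \<equiv> ball_around G out 2 v"
  shows "central (bverts B) (bedges B) v"
  unfolding central_def B_def ball_around_simps(2) ball2_verts by auto

lemma relay_accepts_ball:
  "relay_accepts lev (ball_around G out 2 v) \<longleftrightarrow>
    (\<exists>c. central (bverts (ball_around G out 2 v)) (bedges (ball_around G out 2 v)) c \<and>
       relay_ok lev (bedges (ball_around G out 2 v)) (blabel (ball_around G out 2 v)) c)"
proof -
  have "bedges (ball_around G out 2 v) \<inter> bverts (ball_around G out 2 v) \<times> bverts (ball_around G out 2 v)
    = bedges (ball_around G out 2 v)"
    by (auto simp: ball_around_simps(2))
  then show ?thesis by (simp add: relay_accepts_def Let_def)
qed

lemma relay_accepts_ballI: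
  assumes "relay_ok lev (edges G) (\<lambda>w. (inp G w, out w)) v"
  shows "relay_accepts lev (ball_around G out 2 v)"
  using assms relay_ok_ball central_ball unfolding relay_accepts_ball by blast

text \<open>Acceptance may be due to another central vertex than \<open>v\<close>, so uniqueness is
  assumed. It is stated with the edges of \<open>G\<close>, which contain those of the ball, to
  allow reasoning in the graph itself.\<close>

lemma relay_accepts_ballD:
  assumes "relay_accepts lev (ball_around G out 2 v)"
    and "\<And>c. central (bverts (ball_around G out 2 v)) (edges G) c \<Longrightarrow> c = v"
  shows "relay_ok lev (edges G) (\<lambda>w. (inp G w, out w)) v"
proof -
  obtain c where c: "central (bverts (ball_around G out 2 v)) (bedges (ball_around G out 2 v)) c"
    and ok: "relay_ok lev (bedges (ball_around G out 2 v)) (blabel (ball_around G out 2 v)) c"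
    using assms(1) unfolding relay_accepts_ball by blast
  have "central (bverts (ball_around G out 2 v)) (edges G) c"
    using c unfolding central_def ball_around_simps(2) by blast
  then have "c = v" using assms(2) by blast
  then show ?thesis using ok relay_ok_ball by simp
qed

text \<open>A state consists of the degree, the input and the output once it is decided. Nodes send
  their whole state, and \<open>M\<close> is the set of states received; the order of the ports is
  irrelevant.\<close>

definition relay_step :: "(nat \<Rightarrow> nat) \<Rightarrow> nat \<times> nat \<times> nat option \<Rightarrow> (nat \<times> nat \<times> nat option) set
    \<Rightarrow> nat \<times> nat \<times> nat option" where
  "relay_step lev s M = (case s of (d, l, out) \<Rightarrow>
     let L = {m\<in>M. 1 < fst m \<and> lev (fst m) < lev d}; X = {x. \<exists>m\<in>L. snd (snd m) = Some x}
     in (d, l, if out \<noteq> None then out else if L = {} then Some l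
               else if X = {} then None else Some (SOME x. x \<in> X)))"

definition relay_alg :: "(nat \<Rightarrow> nat) \<Rightarrow> algorithm" where
  "relay_alg lev =
     \<lparr>init = (\<lambda>N i d l. to_nat (d, l, None :: nat option)),
      send = (\<lambda>s j. s),
      receive = (\<lambda>s ms. to_nat (relay_step lev (from_nat s) (from_nat ` set ms))),
      result = (\<lambda>s. snd (snd (from_nat s :: nat \<times> nat \<times> nat option)))\<rparr>"

section \<open>Runs of the relay algorithm on a fixed network\<close>

context
  fixes lev :: "nat \<Rightarrow> nat" and N :: nat and G :: network
  assumes net: "is_network N {0, 1} G"
begin

abbreviation "relay_state \<equiv> state (relay_alg lev) N G"

definition relay_out :: "nat \<Rightarrow> node \<Rightarrow> nat option" where
  "relay_out t v = result (relay_alg lev) (relay_state t v)"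

lemma edges_verts: "(v, w) \<in> edges G \<Longrightarrow> v \<in> verts G \<and> w \<in> verts G"
  using net by (auto simp: is_network_def simple_connected_graph_def)

lemma port_image: "v \<in> verts G \<Longrightarrow> port G v ` {0..<deg G v} = edges G `` {v}"
  using net by (auto simp: is_network_def bij_betw_def nbrs_def atLeast0LessThan)

text \<open>A step never changes the first two components, so a run is described by the outputs
  alone.\<close>

lemma state_relay:
  assumes "v \<in> verts G"
  shows "relay_state t v = to_nat (deg G v, inp G v, relay_out t v)"
proof (cases t)
  case 0
  then show ?thesis by (simp add: relay_out_def relay_alg_def)
next
  case (Suc k)
  have "\<exists>a. relay_step lev (d, l, b) M = (d, l, a)" for d l b M
    by (simp add: relay_step_def Let_def)
  then have "\<exists>a :: nat option. relay_state t v = to_nat (deg G v, inp G v, a)"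
    by (induction t) (auto simp: relay_alg_def)
  then obtain a :: "nat option" where "relay_state t v = to_nat (deg G v, inp G v, a)" by blast
  then show ?thesis by (simp add: relay_out_def relay_alg_def)
qed

definition lower_nbrs :: "node \<Rightarrow> node set" where
  "lower_nbrs v = {w. lower_nbr lev (edges G) v w}"

lemma lower_nbrs_verts: "w \<in> lower_nbrs v \<Longrightarrow> w \<in> verts G"
  using edges_verts by (auto simp: lower_nbrs_def lower_nbr_def)

lemma relay_out_0: "relay_out 0 v = None"
  by (simp add: relay_out_def relay_alg_def)

text \<open>This recurrence replaces the encoded states and the ports in the rest of the
  analysis.\<close>

lemma relay_out_Suc:
  assumes v: "v \<in> verts G"
  shows "relay_out (Suc t) v = (if relay_out t v \<noteq> None then relay_out t v else if lower_nbrs v = {} then Some (inp G v)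
    else if \<forall>w\<in>lower_nbrs v. relay_out t w = None then None else Some (SOME x. \<exists>w\<in>lower_nbrs v. relay_out t w = Some x))"
proof -
  define M where "M = (\<lambda>w. (deg G w, inp G w, relay_out t w)) ` (edges G `` {v})"
  have M: "(\<lambda>i. from_nat (relay_state t (port G v i))) ` {0..<deg G v} = M"
  proof -
    have "(\<lambda>i. from_nat (relay_state t (port G v i))) ` {0..<deg G v} = (\<lambda>w. from_nat (relay_state t w)) ` (edges G `` {v})"
      unfolding port_image[OF v, symmetric] by (simp add: image_image)
    also have "\<dots> = M"
      unfolding M_def by (intro image_cong refl) (use edges_verts in \<open>auto simp: state_relay\<close>)
    finally show ?thesis .
  qed
  have "relay_state (Suc t) v = to_nat (relay_step lev (from_nat (relay_state t v))
      ((\<lambda>i. from_nat (relay_state t (port G v i))) ` {0..<deg G v}))"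
    by (simp add: relay_alg_def image_image)
  also have "\<dots> = to_nat (relay_step lev (deg G v, inp G v, relay_out t v) M)"
    unfolding M state_relay[OF v] by simp
  finally have "relay_state (Suc t) v = to_nat (relay_step lev (deg G v, inp G v, relay_out t v) M)" .
  then have a: "relay_out (Suc t) v = snd (snd (relay_step lev (deg G v, inp G v, relay_out t v) M))"
    by (simp add: relay_out_def relay_alg_def)
  have L: "{m\<in>M. 1 < fst m \<and> lev (fst m) < lev (deg G v)} = (\<lambda>w. (deg G w, inp G w, relay_out t w)) ` lower_nbrs v"
    by (auto simp: M_def lower_nbrs_def lower_nbr_def deg_def nbrs_def)
  show ?thesis
    unfolding a relay_step_def Let_def prod.case L snd_conv by auto
qed

lemma relay_out_mono:
  assumes "v \<in> verts G" "relay_out t v = Some x" "t \<le> t'"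
  shows "relay_out t' v = Some x"
  using assms(3) by (induction rule: dec_induct) (use assms in \<open>auto simp: relay_out_Suc\<close>)

lemma relay_out_unique:
  assumes "v \<in> verts G" "relay_out t v = Some x" "relay_out t' v = Some y"
  shows "x = y"
  using relay_out_mono[OF assms(1,2), of t'] relay_out_mono[OF assms(1,3), of t] assms
  by (cases "t \<le> t'") auto

text \<open>A copied value was present at a lower neighbor in a strictly earlier round. The
  strictness supports the induction on rounds that traces a value back to an input.\<close>

lemma relay_out_sound:
  assumes "v \<in> verts G" "relay_out t v = Some x"
  shows "if lower_nbrs v = {} then x = inp G v else \<exists>w\<in>lower_nbrs v. \<exists>t'<t. relay_out t' w = Some x"
  using assms(2)
proof (induction t)
  case 0
  then show ?case by (simp add: relay_out_0)
next
  case (Suc t)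
  show ?case
  proof (cases "relay_out t v = None")
    case False
    then show ?thesis using Suc assms(1) by (auto simp: relay_out_Suc less_Suc_eq split: if_splits)
  next
    case None: True
    show ?thesis
    proof (cases "lower_nbrs v = {}")
      case True
      then show ?thesis using Suc.prems assms(1) None by (simp add: relay_out_Suc)
    next
      case False
      then have e: "\<exists>x. \<exists>w\<in>lower_nbrs v. relay_out t w = Some x"
        and x: "x = (SOME x. \<exists>w\<in>lower_nbrs v. relay_out t w = Some x)"
        using Suc.prems assms(1) None by (auto simp: relay_out_Suc split: if_splits)
      have "\<exists>w\<in>lower_nbrs v. relay_out t w = Some x" unfolding x using e by (rule someI_ex)
      then show ?thesis using False by auto
    qed
  qed
qed

lemma relay_out_label: "v \<in> verts G \<Longrightarrow> relay_out t v = Some x \<Longrightarrow> x \<in> {0, 1}"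
proof (induction t arbitrary: v rule: less_induct)
  case (less t)
  show ?case
  proof (cases "lower_nbrs v = {}")
    case True
    then show ?thesis using relay_out_sound[OF less.prems] net less.prems(1) by (auto simp: is_network_def)
  next
    case False
    then show ?thesis using relay_out_sound[OF less.prems] less.IH lower_nbrs_verts by auto
  qed
qed

text \<open>By induction on the level, a lower neighbor has answered by round
  \<open>lev (deg G v)\<close>, and copying takes one more round.\<close>

lemma relay_out_total: "v \<in> verts G \<Longrightarrow> relay_out (Suc (lev (deg G v))) v \<noteq> None"
proof (induction "lev (deg G v)" arbitrary: v rule: less_induct)
  case less
  show ?case
  proof (cases "lower_nbrs v = {}")
    case True
    then show ?thesis using less.prems by (simp add: relay_out_Suc)
  next
    case False
    then obtain w where w: "w \<in> lower_nbrs v" by blast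
    then have "lev (deg G w) < lev (deg G v)"
      by (auto simp: lower_nbrs_def lower_nbr_def deg_def nbrs_def)
    then have "relay_out (Suc (lev (deg G w))) w \<noteq> None" "Suc (lev (deg G w)) \<le> lev (deg G v)"
      using less.hyps w lower_nbrs_verts by auto
    then have "relay_out (lev (deg G v)) w \<noteq> None"
      using relay_out_mono w lower_nbrs_verts by blast
    then show ?thesis using less.prems w by (auto simp: relay_out_Suc)
  qed
qed

lemma has_output_relay: "has_output (relay_alg lev) N G v t \<longleftrightarrow> relay_out t v \<noteq> None"
  by (simp add: has_output_def relay_out_def)

lemma out_label_relay:
  assumes "v \<in> verts G"
  shows "relay_out t v = Some x \<Longrightarrow> out_label (relay_alg lev) N G v = x"
    and "\<exists>t. relay_out t v = Some (out_label (relay_alg lev) N G v)"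
proof -
  define T where "T = (LEAST t. relay_out t v \<noteq> None)"
  have "relay_out T v \<noteq> None" unfolding T_def using relay_out_total[OF assms] by (rule LeastI)
  moreover have o: "out_label (relay_alg lev) N G v = the (relay_out T v)"
    by (simp add: out_label_def has_output_relay T_def relay_out_def)
  ultimately have *: "relay_out T v = Some (out_label (relay_alg lev) N G v)" by auto
  then show "\<exists>t. relay_out t v = Some (out_label (relay_alg lev) N G v)" by blast
  show "relay_out t v = Some x \<Longrightarrow> out_label (relay_alg lev) N G v = x"
    using relay_out_unique[OF assms] * by blast
qed

lemma relay_ok_out_label:
  assumes v: "v \<in> verts G"
  shows "relay_ok lev (edges G) (\<lambda>w. (inp G w, out_label (relay_alg lev) N G w)) v"
proof -
  obtain t where "relay_out t v = Some (out_label (relay_alg lev) N G v)"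
    using out_label_relay[OF v] by blast
  from relay_out_sound[OF v this] have "if lower_nbrs v = {} then out_label (relay_alg lev) N G v = inp G v
      else \<exists>w\<in>lower_nbrs v. out_label (relay_alg lev) N G w = out_label (relay_alg lev) N G v"
    using out_label_relay(1) lower_nbrs_verts by (metis (lifting))
  then show ?thesis by (auto simp: relay_ok_def lower_nbrs_def split: if_splits)
qed

lemma rounds_relay:
  assumes "mono lev"
  shows "rounds (relay_alg lev) N G \<le> enat (Suc (lev (card (verts G))))"
  unfolding rounds_def
proof (rule SUP_least)
  fix v assume v: "v \<in> verts G"
  have "deg G v \<le> card (verts G)"
    unfolding deg_def nbrs_def
    using net edges_verts by (intro card_mono) (auto simp: is_network_def simple_connected_graph_def)
  then have "lev (deg G v) \<le> lev (card (verts G))" by (rule monoD[OF assms])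
  moreover have "(INF t\<in>{t. has_output (relay_alg lev) N G v t}. enat t) \<le> enat (Suc (lev (deg G v)))"
    by (rule INF_lower) (use relay_out_total[OF v] in \<open>simp add: has_output_relay\<close>)
  ultimately show "(INF t\<in>{t. has_output (relay_alg lev) N G v t}. enat t) \<le> enat (Suc (lev (card (verts G))))"
    by (meson Suc_le_mono enat_ord_simps(1) order_trans)
qed

end

lemma solves_relay: "solves (relay_alg lev) N (relay_problem lev)"
  unfolding solves_def
proof (intro allI ballI conjI)
  fix n G v
  assume G: "G \<in> instances (relay_problem lev) N n" and v: "v \<in> verts G"
  have net: "is_network (N n) {0, 1} G"
    using G by (simp add: instances_def relay_problem_def)
  show "\<exists>t. has_output (relay_alg lev) (N n) G v t"
    using relay_out_total[OF net v] has_output_relay[OF net] by blast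
  show "out_label (relay_alg lev) (N n) G v \<in> out_labels (relay_problem lev)"
    using out_label_relay(2)[OF net v] relay_out_label[OF net v] by (auto simp: relay_problem_def)
  show "accepts (relay_problem lev)
      (ball_around G (out_label (relay_alg lev) (N n) G) (radius (relay_problem lev)) v)"
    using relay_accepts_ballI[OF relay_ok_out_label[OF net v]] by (simp add: relay_problem_def)
qed

lemma round_complexity_relay:
  assumes "mono lev"
  shows "round_complexity (relay_alg lev) N (relay_problem lev) n \<le> enat (Suc (lev n))"
  unfolding round_complexity_def
proof (rule SUP_least)
  fix G assume G: "G \<in> instances (relay_problem lev) N n"
  then have "is_network (N n) {0, 1} G" "card (verts G) = n"
    by (simp_all add: instances_def relay_problem_def)
  then show "rounds (relay_alg lev) (N n) G \<le> enat (Suc (lev n))"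
    using rounds_relay assms by metis
qed

section \<open>Lower bound on caterpillars\<close>

text \<open>Information crosses one edge per round, so a change of the input at \<open>s\<close>
  stays unnoticed at nodes farther away than \<open>t\<close>.\<close>

lemma state_inp_local:
  assumes net: "is_network M Lin G"
    and G': "G' = G\<lparr>inp := l\<rparr>" and l: "\<And>w. w \<noteq> s \<Longrightarrow> l w = inp G w"
  shows "v \<in> verts G \<Longrightarrow> (\<And>k. k \<le> t \<Longrightarrow> (s, v) \<notin> edges G ^^ k) \<Longrightarrow>
    state A N G' t v = state A N G t v"
proof (induction t arbitrary: v)
  case 0
  have "v \<noteq> s" using 0(2)[of 0] by auto
  then show ?case using l by (simp add: G' deg_def nbrs_def)
next
  case (Suc t)
  have far: "(s, v) \<notin> edges G ^^ k" if "k \<le> Suc t" for k using Suc.prems(2) that by blast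
  have *: "state A N G' t (port G v i) = state A N G t (port G v i)" if i: "i < deg G v" for i
  proof (rule Suc.IH)
    have "port G v i \<in> nbrs G v"
      using net Suc.prems(1) i unfolding is_network_def by (blast dest: bij_betwE)
    then have e: "(v, port G v i) \<in> edges G" by (simp add: nbrs_def)
    then show "port G v i \<in> verts G"
      using net by (auto simp: is_network_def simple_connected_graph_def)
    have "(port G v i, v) \<in> edges G"
      using net e by (auto simp: is_network_def simple_connected_graph_def dest: symD)
    \<comment> \<open>A walk from \<open>s\<close> to the neighbor would extend by one edge to
      \<open>v\<close>.\<close>
    then show "(s, port G v i) \<notin> edges G ^^ k" if "k \<le> t" for k
      using far[of "Suc k"] that by auto
  qed
  have "state A N G' t v = state A N G t v" using Suc.IH Suc.prems far by auto
  then show ?case using *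
    by (auto simp: G' deg_def nbrs_def port_to_def
        intro!: arg_cong[where f = "receive A (state A N G t v)"])
qed

text \<open>The first output occurs by round \<open>T\<close>, up to which the runs agree; what
  happens later cannot change the label.\<close>

lemma out_label_cong:
  assumes "has_output A N G v T" and "\<And>t. t \<le> T \<Longrightarrow> state A N G' t v = state A N G t v"
  shows "out_label A N G' v = out_label A N G v"
proof -
  define L where "L = (LEAST t. has_output A N G v t)"
  have L: "has_output A N G v L" "L \<le> T"
    using assms(1) unfolding L_def by (auto intro: LeastI Least_le)
  have eq: "has_output A N G' v t \<longleftrightarrow> has_output A N G v t" if "t \<le> T" for t
    using assms(2)[OF that] by (simp add: has_output_def)
  have "(LEAST t. has_output A N G' v t) = L"
  proof (rule Least_equality)
    show "has_output A N G' v L" using eq L by blast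
    show "L \<le> y" if "has_output A N G' v y" for y
    proof (cases "y \<le> T")
      case True
      then show ?thesis using eq that unfolding L_def by (auto intro: Least_le)
    qed (use L in simp)
  qed
  then show ?thesis using assms(2)[OF L(2)] by (simp add: out_label_def L_def)
qed

lemma rounds_ge:
  assumes "v \<in> verts G" "\<And>t. t < r \<Longrightarrow> \<not> has_output A N G v t"
  shows "enat r \<le> rounds A N G"
  unfolding rounds_def
  by (rule SUP_upper2[OF assms(1)], rule INF_greatest) (use assms(2) in \<open>auto simp: not_less[symmetric]\<close>)

text \<open>The spine is \<open>0, \<dots>, m\<close>; every node \<open>x > m\<close> is a leg attached to \<open>f x\<close>.\<close>

definition caterpillar :: "nat \<Rightarrow> nat \<Rightarrow> (nat \<Rightarrow> nat) \<Rightarrow> node rel" where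
  "caterpillar n m f =
     {(x, y). x < n \<and> y < n \<and> x \<le> m \<and> (y \<le> m \<and> y = Suc x \<or> m < y \<and> f y = x)} \<union>
     {(x, y). x < n \<and> y < n \<and> y \<le> m \<and> (x \<le> m \<and> x = Suc y \<or> m < x \<and> f x = y)}"

text \<open>\<open>D i\<close> is the degree of an inner spine node \<open>i\<close>: two spine
  neighbors and \<open>D i - 2\<close> legs. Node 0 has enough legs not to be of lower level than
  node 1. The end \<open>m\<close> has one spine neighbor, hence degree \<open>D m - 1\<close>,
  whose level is still not below that of \<open>m - 1\<close>.\<close>

locale caterpillar_net =
  fixes n m :: nat and f :: "nat \<Rightarrow> nat" and lev D :: "nat \<Rightarrow> nat"
  assumes m: "2 \<le> m" "m < n"
    and f: "\<And>x. m < x \<Longrightarrow> x < n \<Longrightarrow> f x \<le> m"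
    and card_legs: "\<And>i. 0 < i \<Longrightarrow> i \<le> m \<Longrightarrow> card {x. m < x \<and> x < n \<and> f x = i} = D i - 2"
    and card_legs_0: "D 1 - 1 \<le> card {x. m < x \<and> x < n \<and> f x = 0}"
    and lev_mono: "mono lev"
    and D3: "\<And>i. 0 < i \<Longrightarrow> 3 \<le> D i"
    and lev_D: "\<And>i. 0 < i \<Longrightarrow> lev (D i) = i"
    and lev_D_end: "m - 1 \<le> lev (D m - 1)"
begin

section \<open>Degrees, lower neighbors and distances in the caterpillar\<close>

abbreviation "E \<equiv> caterpillar n m f"

definition legs :: "nat \<Rightarrow> nat set" where "legs i = {x. m < x \<and> x < n \<and> f x = i}"

lemma finite_legs [simp]: "finite (legs i)"
  by (rule finite_subset[of _ "{..<n}"]) (auto simp: legs_def)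

lemma sym_E: "(x, y) \<in> E \<Longrightarrow> (y, x) \<in> E"
  by (auto simp: caterpillar_def)

lemma img_leg: "m < v \<Longrightarrow> v < n \<Longrightarrow> E `` {v} = {f v}"
  using f[of v] m by (auto simp: caterpillar_def)

lemma img_0: "E `` {0} = insert 1 (legs 0)"
  using m by (auto simp: caterpillar_def legs_def)

lemma img_mid: "0 < i \<Longrightarrow> i < m \<Longrightarrow> E `` {i} = insert (i - 1) (insert (Suc i) (legs i))"
  using m by (auto simp: caterpillar_def legs_def)

lemma img_end: "E `` {m} = insert (m - 1) (legs m)"
  using m by (auto simp: caterpillar_def legs_def)

lemma card_leg: "m < v \<Longrightarrow> v < n \<Longrightarrow> card (E `` {v}) = 1"
  by (simp add: img_leg)

lemma card_0: "D 1 \<le> card (E `` {0})"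
  using m card_legs_0 D3[of 1] by (simp add: img_0) (auto simp: legs_def card_insert_if)

lemma card_mid: "0 < i \<Longrightarrow> i < m \<Longrightarrow> card (E `` {i}) = D i"
  using card_legs[of i] D3[of i] by (simp add: img_mid) (auto simp: legs_def card_insert_if)

lemma card_end: "card (E `` {m}) = D m - 1"
  using m card_legs[of m] D3[of m] by (simp add: img_end) (auto simp: legs_def card_insert_if)

text \<open>Legs are leaves, the next spine node has level at least \<open>i\<close> even if it is
  the end, and node 0 has level at least 1. This leaves only the preceding spine node.\<close>

lemma lower_nbr_spine:
  assumes i: "0 < i" "i < m"
  shows "lower_nbr lev E i w \<longleftrightarrow> 1 < i \<and> w = i - 1"
proof
  assume low: "lower_nbr lev E i w"
  then have w: "w \<in> E `` {i}" and d: "1 < card (E `` {w})" and l: "lev (card (E `` {w})) < i"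
    using i by (auto simp: lower_nbr_def card_mid lev_D)
  have "w \<notin> legs i" using d card_leg[of w] by (auto simp: legs_def)
  moreover have "w \<noteq> Suc i"
  proof
    assume w: "w = Suc i"
    show False
    proof (cases "w < m")
      case True
      then show ?thesis using l w by (simp add: card_mid lev_D)
    next
      case False
      then have "w = m" using w i by simp
      then show ?thesis using l w lev_D_end by (simp add: card_end)
    qed
  qed
  ultimately have w: "w = i - 1" using w i by (auto simp: img_mid)
  have "i \<noteq> 1"
  proof
    assume "i = 1"
    then have "lev (D 1) \<le> lev (card (E `` {w}))" using monoD[OF lev_mono card_0] w by simp
    then show False using l \<open>i = 1\<close> by (simp add: lev_D)
  qed
  with w i show "1 < i \<and> w = i - 1" by simp
next
  assume w: "1 < i \<and> w = i - 1"
  then have "card (E `` {w}) = D (i - 1)" using i card_mid[of w] by simp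
  moreover have "(i, w) \<in> E" using img_mid[OF i] w by auto
  ultimately show "lower_nbr lev E i w"
    using w i D3[of "i - 1"] by (simp add: lower_nbr_def card_mid lev_D)
qed

lemma legs_nonempty: "i \<le> m \<Longrightarrow> \<exists>a. a \<in> legs i"
proof -
  assume i: "i \<le> m"
  have "0 < card (legs i)"
    using card_legs[of i] card_legs_0 D3[of i] D3[of 1] i by (cases "i = 0") (auto simp: legs_def)
  then show ?thesis by (auto simp: card_gt_0_iff)
qed

text \<open>A vertex within distance 2 of a leg at \<open>i - 1\<close> and of a leg at \<open>i + 1\<close> is \<open>i\<close>. This is why the
  end \<open>m\<close> of the spine is not used for the lower bound.\<close>

lemma center_unique:
  assumes i: "0 < i" "i < m" and G: "edges G = E"
    and c: "central (bverts (ball_around G out 2 i)) E c"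
  shows "c = i"
proof -
  obtain a b where a: "a \<in> legs (i - 1)" and b: "b \<in> legs (Suc i)"
    using legs_nonempty[of "i - 1"] legs_nonempty[of "Suc i"] i by (meson Suc_leI diff_le_self le_trans less_imp_le)
  \<comment> \<open>The only neighbor of the leg \<open>u\<close> is \<open>j\<close>, so a path of
    at most two edges to \<open>u\<close> starts at \<open>u\<close>, at \<open>j\<close> or next to
    \<open>j\<close>.\<close>
  have near: "c = u \<or> c = j \<or> (c, j) \<in> E" if u: "u \<in> legs j" and ij: "(i, j) \<in> E" for u j
  proof -
    have img: "E `` {u} = {j}" using u img_leg by (auto simp: legs_def)
    then have "(j, u) \<in> E" using sym_E by auto
    then have "u \<in> bverts (ball_around G out 2 i)" using ij by (auto simp: ball2_verts G)
    then have "u = c \<or> (c, u) \<in> E \<or> (c, u) \<in> E O E" using c by (auto simp: central_def)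
    moreover have "(x, u) \<in> E \<Longrightarrow> x = j" for x using img sym_E by blast
    ultimately show ?thesis by blast
  qed
  have "c = a \<or> c = i - 1 \<or> (c, i - 1) \<in> E"
    by (rule near[OF a]) (use img_mid[OF i] in auto)
  moreover have "c = b \<or> c = Suc i \<or> (c, Suc i) \<in> E"
    by (rule near[OF b]) (use img_mid[OF i] in auto)
  ultimately show ?thesis
    using a b i by (auto simp: caterpillar_def legs_def)
qed

text \<open>The spine position, taken at the attachment point for a leg, grows by at most one per
  edge.\<close>

lemma dist_spine: "(1, v) \<in> E ^^ k \<Longrightarrow> (if v \<le> m then v else f v) \<le> Suc k"
proof (induction k arbitrary: v)
  case 0
  then show ?case using m by auto
next
  case (Suc k)
  then obtain w where "(1, w) \<in> E ^^ k" "(w, v) \<in> E" by auto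
  with Suc.IH[of w] show ?case using f by (auto simp: caterpillar_def split: if_splits)
qed

lemma graph: "simple_connected_graph {..<n} E"
proof -
  have r: "(0, x) \<in> E\<^sup>*" if "x \<le> m" for x
    using that
  proof (induction x)
    case (Suc x)
    then have "(x, Suc x) \<in> E" using m by (auto simp: caterpillar_def)
    with Suc show ?case by (auto intro: rtrancl_into_rtrancl)
  qed simp
  have R: "(0, x) \<in> E\<^sup>*" if "x < n" for x
  proof (cases "x \<le> m")
    case False
    then have "(f x, x) \<in> E" "f x \<le> m" using f[of x] that m by (auto simp: caterpillar_def)
    then show ?thesis using r by (auto intro: rtrancl_into_rtrancl)
  qed (rule r)
  have "sym E" using sym_E by (auto intro: symI)
  then have "(x, 0) \<in> E\<^sup>*" if "x < n" for x using R[OF that] sym_rtrancl by (auto dest: symD)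
  then have "{..<n} \<times> {..<n} \<subseteq> E\<^sup>*" using R rtrancl_trans by fast
  then show ?thesis
    unfolding simple_connected_graph_def using \<open>sym E\<close> m
    by (auto simp: caterpillar_def irrefl_def)
qed

section \<open>Two networks that differ only in the input of node 1\<close>

definition net :: "nat \<Rightarrow> network" where
  "net b = \<lparr>verts = {..<n}, edges = E, ident = id, inp = (\<lambda>v. if v = 1 then b else 0),
     port = (\<lambda>v. SOME p. bij_betw p {..<card (E `` {v})} (E `` {v}))\<rparr>"

lemma net_sel [simp]:
  "verts (net b) = {..<n}" "edges (net b) = E" "inp (net b) = (\<lambda>v. if v = 1 then b else 0)"
  by (simp_all add: net_def)

lemma net_instance:
  assumes "n \<le> N n" "b \<in> {0, 1}"
  shows "net b \<in> instances (relay_problem lev) N n"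
proof -
  have "bij_betw (port (net b) v) {..<deg (net b) v} (nbrs (net b) v)" for v
  proof -
    have "finite (E `` {v})" by (rule finite_subset[of _ "{..<n}"]) (auto simp: caterpillar_def)
    then have "\<exists>p. bij_betw p {..<card (E `` {v})} (E `` {v})"
      using ex_bij_betw_nat_finite by (simp add: atLeast0LessThan)
    from someI_ex[OF this] show ?thesis by (simp add: net_def deg_def nbrs_def)
  qed
  moreover have "ident (net b) = id" by (simp add: net_def)
  ultimately show ?thesis
    using assms graph by (auto simp: instances_def relay_problem_def is_network_def)
qed

text \<open>Node 1 has no lower neighbor and must output its input \<open>b\<close>; every later
  inner spine node can only copy its predecessor.\<close>

lemma out_label_spine:
  assumes sol: "solves A N (relay_problem lev)" and N: "n \<le> N n" "b \<in> {0, 1}"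
    and i: "0 < i" "i < m"
  shows "out_label A (N n) (net b) i = b"
proof -
  have ok: "relay_ok lev E (\<lambda>w. (inp (net b) w, out_label A (N n) (net b) w)) i"
    if i: "0 < i" "i < m" for i
  proof -
    have "i \<in> verts (net b)" using i m by simp
    then have "relay_accepts lev (ball_around (net b) (out_label A (N n) (net b)) 2 i)"
      using sol net_instance[of N, OF N] by (auto simp: solves_def relay_problem_def)
    then have "relay_ok lev (edges (net b)) (\<lambda>w. (inp (net b) w, out_label A (N n) (net b) w)) i"
      by (rule relay_accepts_ballD) (use center_unique[OF i net_sel(2)] in simp)
    then show ?thesis by simp
  qed
  show ?thesis
    using i
  proof (induction i rule: nat_induct_non_zero)
    case 1
    then show ?case using ok[of 1] by (simp add: relay_ok_def lower_nbr_spine)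
  next
    case (Suc i)
    then show ?case
      using ok[of "Suc i"] by (auto simp: relay_ok_def lower_nbr_spine split: if_splits)
  qed
qed

text \<open>Inputs 0 and 1 at node 1 force different outputs at \<open>m - 1\<close>, the last inner
  spine node. It is \<open>m - 2\<close> edges away and cannot distinguish the two networks any
  earlier.\<close>

lemma round_complexity_ge:
  assumes sol: "solves A N (relay_problem lev)" and N: "n \<le> N n"
  shows "enat (m - 2) \<le> round_complexity A N (relay_problem lev) n"
proof -
  have inst: "net 0 \<in> instances (relay_problem lev) N n" using net_instance N by simp
  have "enat (m - 2) \<le> rounds A (N n) (net 0)"
  proof (rule rounds_ge)
    show v: "m - 1 \<in> verts (net 0)" using m by simp
    show "\<not> has_output A (N n) (net 0) (m - 1) T" if T: "T < m - 2" for T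
    proof
      assume out: "has_output A (N n) (net 0) (m - 1) T"
      have "state A (N n) (net 1) t (m - 1) = state A (N n) (net 0) t (m - 1)" if "t \<le> T" for t
      proof (rule state_inp_local[of _ _ "net 0" _ _ 1])
        show "is_network (N n) {0, 1} (net 0)"
          using inst by (simp add: instances_def relay_problem_def)
        show "net 1 = (net 0)\<lparr>inp := \<lambda>v. if v = 1 then 1 else 0\<rparr>"
          by (simp add: net_def fun_eq_iff)
        show "(1, m - 1) \<notin> edges (net 0) ^^ k" if "k \<le> t" for k
          using dist_spine[of "m - 1" k] that \<open>t \<le> T\<close> T by auto
      qed (use v in auto)
      then have "out_label A (N n) (net 1) (m - 1) = out_label A (N n) (net 0) (m - 1)"
        using out_label_cong[OF out] by blast
      then show False
        using out_label_spine[OF sol N, of 0 "m - 1"] out_label_spine[OF sol N, of 1 "m - 1"] m by simp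
    qed
  qed
  also have "\<dots> \<le> round_complexity A N (relay_problem lev) n"
    unfolding round_complexity_def using inst by (rule SUP_upper)
  finally show ?thesis .
qed

end

section \<open>Fitting a long caterpillar into \<open>n\<close> nodes\<close>

lemma ex_fun_card_fibres:
  fixes L :: "nat \<Rightarrow> nat"
  assumes "finite X" "sum L {1..m} \<le> card X"
  shows "\<exists>f. f ` X \<subseteq> {0..m} \<and> (\<forall>i\<in>{1..m}. card {x\<in>X. f x = i} = L i) \<and>
    card {x\<in>X. f x = 0} = card X - sum L {1..m}"
  using assms
proof (induction m arbitrary: X)
  case 0
  show ?case by (intro exI[of _ "\<lambda>_. 0"]) auto
next
  case (Suc m)
  have s: "sum L {1..Suc m} = sum L {1..m} + L (Suc m)" by simp
  \<comment> \<open>A block of the size prescribed for the last value is cut off; elements left over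
    at the end are sent to 0.\<close>
  then obtain Y where Y: "Y \<subseteq> X" "card Y = L (Suc m)"
    using Suc.prems obtain_subset_with_card_n[of "L (Suc m)" X] by auto
  then have c: "card (X - Y) = card X - L (Suc m)"
    using Suc.prems by (simp add: card_Diff_subset finite_subset)
  then obtain f where f: "f ` (X - Y) \<subseteq> {0..m}"
    "\<And>i. i \<in> {1..m} \<Longrightarrow> card {x \<in> X - Y. f x = i} = L i"
    "card {x \<in> X - Y. f x = 0} = card (X - Y) - sum L {1..m}"
  proof -
    have "sum L {1..m} \<le> card (X - Y)" "finite (X - Y)" using c Suc.prems s by auto
    then show thesis using Suc.IH[of "X - Y"] that by blast
  qed
  define g where "g x = (if x \<in> Y then Suc m else f x)" for x
  have g: "{x\<in>X. g x = i} = {x\<in>X - Y. f x = i}" if "i \<le> m" for i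
    using that by (auto simp: g_def)
  have g': "{x\<in>X. g x = Suc m} = Y"
    using f(1) Y(1) by (auto simp: g_def split: if_splits)
  have "g ` X \<subseteq> {0..Suc m}" using f(1) by (force simp: g_def)
  moreover have "card {x\<in>X. g x = i} = L i" if "i \<in> {1..Suc m}" for i
    using that f(2) g g' Y(2) by (cases "i = Suc m") auto
  moreover have "card {x\<in>X. g x = 0} = card X - sum L {1..Suc m}"
    using g[of 0] f(3) c s by simp
  ultimately show ?case by blast
qed

text \<open>Taking for \<open>D i\<close> the least degree of level at least \<open>i\<close>, these
  degrees at least double, so their sum is at most twice the last one.\<close>

lemma relay_lower_bound:
  fixes lev :: "nat \<Rightarrow> nat"
  assumes lev_mono: "mono lev" and step: "\<And>d. lev (2 * d + 1) \<le> Suc (lev d)" and lev_2: "lev 2 = 0"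
    and lim: "filterlim lev at_top sequentially"
    and sol: "solves A N (relay_problem lev)" and N: "n \<le> N n" and n: "4 \<le> lev n"
  shows "enat (lev n - 4) \<le> round_complexity A N (relay_problem lev) n"
proof -
  define D where "D i = (LEAST d. i \<le> lev d)" for i
  \<comment> \<open>The two levels given up make \<open>n\<close> at least four times
    \<open>D m\<close>; two more are lost because the bit travels only from 1 to
    \<open>m - 1\<close>.\<close>
  define m where "m = lev n - 2"
  have "\<exists>d. i \<le> lev d" for i
    using lim by (auto simp: filterlim_at_top eventually_sequentially)
  then have ge: "i \<le> lev (D i)" for i
    unfolding D_def by (rule LeastI_ex)
  have less: "lev d < i" if "d < D i" for d i
    using not_less_Least[of d "\<lambda>d. i \<le> lev d"] that by (auto simp: D_def)
  have D3: "3 \<le> D i" if "0 < i" for i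
  proof (rule ccontr)
    assume "\<not> 3 \<le> D i"
    then have "lev (D i) \<le> lev 2" by (intro monoD[OF lev_mono]) simp
    then show False using ge[of i] lev_2 that by simp
  qed
  have dbl: "2 * D i \<le> D (Suc i)" if "0 < i" for i
  proof (rule ccontr)
    define d where "d = D i - 1"
    assume "\<not> 2 * D i \<le> D (Suc i)"
    \<comment> \<open>By minimality \<open>d = D i - 1\<close> has level below \<open>i\<close>, so
      \<open>2 * d + 1\<close> cannot reach level \<open>Suc i\<close>.\<close>
    then have "D (Suc i) \<le> 2 * d + 1" by (simp add: d_def)
    then have "Suc i \<le> Suc (lev d)"
      using ge[of "Suc i"] monoD[OF lev_mono, of "D (Suc i)" "2 * d + 1"] step[of d] by linarith
    moreover have "lev d < i" using D3[OF that] by (intro less) (simp add: d_def)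
    ultimately show False by simp
  qed
  have lev_D: "lev (D i) = i" if "0 < i" for i
    using ge[of i] less[of "D i" "Suc i"] dbl[OF that] D3[OF that] by simp
  have m: "2 \<le> m" using n by (simp add: m_def)
  have sum_D: "sum D {1..k} \<le> 2 * D k" if "0 < k" for k
    using that by (induction k rule: nat_induct_non_zero) (use dbl in \<open>auto dest: order_trans\<close>)
  have D1: "D 1 \<le> D k" if "0 < k" for k
    using that
  proof (induction k rule: nat_induct_non_zero)
    case (Suc k)
    then show ?case using dbl[of k] by simp
  qed simp
  have "4 * D m \<le> D (Suc (Suc m))" using dbl[of m] dbl[of "Suc m"] m by simp
  also have "D (Suc (Suc m)) \<le> n" unfolding D_def using n by (intro Least_le) (simp add: m_def)
  finally have n4: "4 * D m \<le> n" .
  have "sum (\<lambda>i. D i - 2) {1..m} + 2 * m = sum D {1..m}"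
  proof -
    have "sum D {1..m} = (\<Sum>i=1..m. (D i - 2) + 2)"
    proof (intro sum.cong refl)
      fix i assume "i \<in> {1..m}"
      then show "D i = D i - 2 + 2" using D3[of i] by simp
    qed
    then show ?thesis by (simp add: sum.distrib del: add_2_eq_Suc')
  qed
  \<comment> \<open>The left side counts \<open>m + 1\<close> spine nodes, the prescribed legs, and
    \<open>D 1 - 1\<close> legs for node 0. All other nodes become legs of node 0 as well.\<close>
  then have s: "sum (\<lambda>i. D i - 2) {1..m} + D 1 + m \<le> n"
    using sum_D[of m] D1[of m] n4 m by simp
  have "D 1 \<ge> 3" using D3 by simp
  with s have mn: "m < n" by simp
  have "sum (\<lambda>i. D i - 2) {1..m} \<le> card {m<..<n}" using s \<open>D 1 \<ge> 3\<close> by simp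
  from ex_fun_card_fibres[OF _ this] obtain f where
    f: "f ` {m<..<n} \<subseteq> {0..m}"
    "\<And>i. i \<in> {1..m} \<Longrightarrow> card {x \<in> {m<..<n}. f x = i} = D i - 2"
    "card {x \<in> {m<..<n}. f x = 0} = card {m<..<n} - sum (\<lambda>i. D i - 2) {1..m}"
    by auto
  have "caterpillar_net n m f lev D"
  proof
    show "card {x. m < x \<and> x < n \<and> f x = i} = D i - 2" if "0 < i" "i \<le> m" for i
      using f(2)[of i] that by (simp add: conj_assoc)
    show "D 1 - 1 \<le> card {x. m < x \<and> x < n \<and> f x = 0}"
      using f(3) s by (simp add: conj_assoc)
    show "f x \<le> m" if "m < x" "x < n" for x using f(1) that by (force simp: image_subset_iff)
    have "D (m - 1) \<le> D m - 1" using dbl[of "m - 1"] D3[of "m - 1"] m by simp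
    then have "lev (D (m - 1)) \<le> lev (D m - 1)" by (rule monoD[OF lev_mono])
    then show "m - 1 \<le> lev (D m - 1)" using lev_D[of "m - 1"] m by simp
  qed (use m mn lev_mono D3 lev_D in auto)
  then show ?thesis
    using caterpillar_net.round_complexity_ge[OF _ sol N] by (fastforce simp: m_def)
qed

section \<open>Matching upper and lower bounds\<close>

lemma slow_complexity:
  assumes "slow g"
  shows "\<exists>P. locally_checkable P \<and> has_complexity_Theta P (\<lambda>n. g (log_star (real n)))"
proof -
  from slow_levels[OF assms] obtain lev :: "nat \<Rightarrow> nat" where
    lev: "mono lev" "\<And>d. lev (2 * d + 1) \<le> Suc (lev d)" "lev 2 = 0"
      "filterlim lev at_top sequentially"
    and lo: "\<forall>\<^sub>F n in sequentially. real (lev n) \<le> g (log_star (real n))"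
    and hi: "\<forall>\<^sub>F n in sequentially. g (log_star (real n)) \<le> 2 * real (lev n)"
    by blast
  have large: "\<forall>\<^sub>F n in sequentially. 8 \<le> lev n" using lev(4) by (simp add: filterlim_at_top)
  have "has_complexity_Theta (relay_problem lev) (\<lambda>n. g (log_star (real n)))"
    unfolding has_complexity_Theta_def
  proof (intro allI impI conjI)
    fix N assume N: "poly_upper_bound N"
    have "in_bigo (round_complexity (relay_alg lev) N (relay_problem lev)) (\<lambda>n. g (log_star (real n)))"
      unfolding in_bigo_def
    \<comment> \<open>For large \<open>n\<close>,
      \<open>Suc (lev n) \<le> 2 * lev n\<close>.\<close>
    proof (intro exI[of _ 2] conjI)
      show "\<forall>\<^sub>F n in sequentially.
          ereal_of_enat (round_complexity (relay_alg lev) N (relay_problem lev) n)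
            \<le> ereal (2 * g (log_star (real n)))"
        using lo large
      proof eventually_elim
        case (elim n)
        have "ereal_of_enat (round_complexity (relay_alg lev) N (relay_problem lev) n)
            \<le> ereal_of_enat (enat (Suc (lev n)))"
          using round_complexity_relay[OF lev(1)] by (simp only: ereal_of_enat_le_iff)
        also have "\<dots> \<le> ereal (2 * g (log_star (real n)))" using elim by simp
        finally show ?case .
      qed
    qed simp
    then show "\<exists>A. solves A N (relay_problem lev) \<and>
        in_bigo (round_complexity A N (relay_problem lev)) (\<lambda>n. g (log_star (real n)))"
      using solves_relay by blast
  next
    fix N A assume N: "poly_upper_bound N" and sol: "solves A N (relay_problem lev)"
    show "in_bigomega (round_complexity A N (relay_problem lev)) (\<lambda>n. g (log_star (real n)))"
      unfolding in_bigomega_def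
    \<comment> \<open>One factor 1/2 comes from comparing \<open>lev n\<close> with
      \<open>g\<close>, the other from \<open>lev n - 4 \<ge> lev n / 2\<close>, valid once
      \<open>lev n \<ge> 8\<close>.\<close>
    proof (intro exI[of _ "1 / 4"] conjI)
      show "\<forall>\<^sub>F n in sequentially. ereal (1 / 4 * g (log_star (real n)))
          \<le> ereal_of_enat (round_complexity A N (relay_problem lev) n)"
        using hi large
      proof eventually_elim
        case (elim n)
        have nN: "n \<le> N n" using N by (simp add: poly_upper_bound_def)
        from elim have "1 / 4 * g (log_star (real n)) \<le> real (lev n - 4)" by linarith
        then have "ereal (1 / 4 * g (log_star (real n))) \<le> ereal_of_enat (enat (lev n - 4))"
          by simp
        also have "\<dots> \<le> ereal_of_enat (round_complexity A N (relay_problem lev) n)"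
          using relay_lower_bound[OF lev sol nN] elim by (simp only: ereal_of_enat_le_iff)
        finally show ?case .
      qed
    qed simp
  qed
  then show ?thesis using locally_checkable_relay_problem by blast
qed

theorem corollary14:
  shows "(\<exists>P. locally_checkable P \<and>
            has_complexity_Theta P (\<lambda>n. real (log_star (real (log_star (real n))))))
       \<and> (\<forall>\<epsilon>::real. 0 < \<epsilon> \<and> \<epsilon> < 1 \<longrightarrow>
            (\<exists>P. locally_checkable P \<and>
               has_complexity_Theta P (\<lambda>n. log 2 (real (log_star (real n))) powr \<epsilon>)))
       \<and> (\<forall>k::nat. 1 \<le> k \<longrightarrow>
            (\<exists>P. locally_checkable P \<and>
               has_complexity_Theta P (\<lambda>n. (log 2 ^^ k) (real (log_star (real n))))))"
proof (intro conjI allI impI)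
  show "\<exists>P. locally_checkable P \<and>
      has_complexity_Theta P (\<lambda>n. real (log_star (real (log_star (real n)))))"
    using slow_complexity[OF slow_log_star] .
next
  fix \<epsilon> :: real assume "0 < \<epsilon> \<and> \<epsilon> < 1"
  then have "slow (\<lambda>p. log 2 (real p) powr \<epsilon>)"
    by (intro slow_powr slow_log slow_of_nat) auto
  then show "\<exists>P. locally_checkable P \<and>
      has_complexity_Theta P (\<lambda>n. log 2 (real (log_star (real n))) powr \<epsilon>)"
    by (rule slow_complexity)
next
  fix k :: nat
  show "\<exists>P. locally_checkable P \<and>
      has_complexity_Theta P (\<lambda>n. (log 2 ^^ k) (real (log_star (real n))))"
    using slow_complexity[OF slow_log_iter] .
qed

end
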